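(* Let $n\ge 1$, let $S_1,\dots,S_n\subseteq\mathbb{K}$ be finite sets and denote $|S_i|=k_i$. Then for any integer $d$ with $0\le d\le\min_i k_i$, the maximal number of roots that a tropical polynomial $p$ over $\mathbb{K}$ in $n$ variables, of degree $d$ and having at least one monomial, can have in $S_1\times\dots\times S_n$ is equal to $$\prod_{i=1}^n k_i-\prod_{i=1}^n (k_i-d).$$ Exactly the same statement is true for polynomials with individual degree in each variable at most $d$, i.e. the maximal number of roots in $S_1\times\dots\times S_n$ of a tropical polynomial with at least one monomial and individual degree at most $d$ in each variable is also equal to $\prod_{i=1}^n k_i-\prod_{i=1}^n (k_i-d)$.
   Context: $\mathbb{K}$ is $\mathbb{R}$ or $\mathbb{Q}$. A tropical polynomial over $\mathbb{K}$ in $\vec{x}=(x_1,\dots,x_n)$ is a finite collection of tropical monomials $m_J(\vec{x}) = c_J + j_1x_1+\dots+j_nx_n$ with pairwise distinct exponent vectors $J=(j_1,\dots,j_n)$ of nonnegative integers and constants $c_J\in\mathbb{K}$; its value is $p(\vec{x})=\max_J m_J(\vec{x})$. The degree of a monomial is $j_1+\dots+j_n$, the degree of $p$ is the maximal degree of its monomials, and the individual degree of $p$ in $x_i$ is the maximal $j_i$ over its monomials. A point $\vec{a}\in\mathbb{K}^n$ is a root of $p$ if the maximum $\max_J m_J(\vec{a})$ is attained on at least two distinct monomials. *)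

theory Defs
  imports Complex_Main "HOL-Library.FuncSet"
begin

text \<open>
  Vectors of length \<open>n\<close> are extensional functions on \<open>{1..n}\<close>. A tropical polynomial is
  a finite map sending the exponent vector of each of its monomials to its constant, so
  distinct monomials have distinct exponent vectors by construction. A constant \<open>0\<close> is an
  ordinary one; absent monomials are those outside the domain.
\<close>

type_synonym expvec = "nat \<Rightarrow> nat"
type_synonym trop_poly = "expvec \<Rightarrow> real option"

definition trop_poly_over :: "real set \<Rightarrow> nat \<Rightarrow> trop_poly \<Rightarrow> bool" where
  "trop_poly_over K n p \<longleftrightarrow>
     finite (dom p) \<and> dom p \<subseteq> ({1..n} \<rightarrow>\<^sub>E (UNIV :: nat set)) \<and> ran p \<subseteq> K"

definition monom_value :: "nat \<Rightarrow> trop_poly \<Rightarrow> expvec \<Rightarrow> (nat \<Rightarrow> real) \<Rightarrow> real" where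
  "monom_value n p J x = the (p J) + (\<Sum>i\<in>{1..n}. real (J i) * x i)"

text \<open>
  The next three notions are meaningful only for polynomials with at least one monomial.
\<close>

definition trop_value :: "nat \<Rightarrow> trop_poly \<Rightarrow> (nat \<Rightarrow> real) \<Rightarrow> real" where
  "trop_value n p x = Max ((\<lambda>J. monom_value n p J x) ` dom p)"

definition trop_degree :: "nat \<Rightarrow> trop_poly \<Rightarrow> nat" where
  "trop_degree n p = Max ((\<lambda>J. \<Sum>i\<in>{1..n}. J i) ` dom p)"

definition indiv_degree :: "trop_poly \<Rightarrow> nat \<Rightarrow> nat" where
  "indiv_degree p i = Max ((\<lambda>J. J i) ` dom p)"

definition trop_root :: "nat \<Rightarrow> trop_poly \<Rightarrow> (nat \<Rightarrow> real) \<Rightarrow> bool" where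
  "trop_root n p a \<longleftrightarrow>
     (\<exists>J\<in>dom p. \<exists>J'\<in>dom p. J \<noteq> J' \<and>
        monom_value n p J a = trop_value n p a \<and> monom_value n p J' a = trop_value n p a)"

definition num_roots :: "nat \<Rightarrow> trop_poly \<Rightarrow> (nat \<Rightarrow> real set) \<Rightarrow> nat" where
  "num_roots n p S = card {a \<in> (\<Pi>\<^sub>E i\<in>{1..n}. S i). trop_root n p a}"

definition is_maximum :: "'a::order set \<Rightarrow> 'a \<Rightarrow> bool" where
  "is_maximum A m \<longleftrightarrow> m \<in> A \<and> (\<forall>a\<in>A. a \<le> m)"

end

theory Submission imports Defs begin

text \<open>
  \<^bold>\<open>Upper bound.\<close> As every individual degree is at most the total degree, it suffices to find
  \<open>\<Prod>(k\<^sub>i - d)\<close> non-roots for a polynomial of individual degrees at most \<open>d\<close>. Classically one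
  would argue as follows: were there fewer, linear algebra would give a nonzero polynomial \<open>q\<close>
  with degree below \<open>k\<^sub>i - d\<close> in \<open>x\<^sub>i\<close> vanishing at all of them, and then \<open>p q\<close>, of degree below
  \<open>k\<^sub>i\<close> in \<open>x\<^sub>i\<close>, would vanish on the whole grid, which is impossible. Both ingredients have
  tropical analogues. That a system with more unknowns than equations is solvable follows
  from Cramer's rule, with maximal-weight injections in place of minors
  (\<open>underdetermined_tropical_system\<close>). That a polynomial of small degree
  cannot vanish on the whole grid follows from convexity: let \<open>s\<^sub>i(0) < s\<^sub>i(1) < \<dots>\<close> enumerate
  \<open>S\<^sub>i\<close> and let \<open>\<phi>\<^sub>i\<close> be a strictly convex function with subgradient \<open>s\<^sub>i(t)\<close> at \<open>t\<close>. If the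
  exponent vector \<open>L\<close> maximises the coefficient of \<open>L\<close> plus \<open>\<Sum>\<phi>\<^sub>i(L\<^sub>i)\<close>, then at the grid point
  \<open>(s\<^sub>i(L\<^sub>i))\<close> the monomial \<open>L\<close> strictly dominates all others. In the proof of
  \<open>card_nonroots_ge\<close> the product \<open>p q\<close> is never formed: one maximises over pairs of a
  monomial of \<open>p\<close> and a monomial of \<open>q\<close> and reads off a grid point that is a root of neither,
  whereas \<open>q\<close> was chosen so that every grid point is a root of \<open>p\<close> or of \<open>q\<close>.

  \<^bold>\<open>Attaining the bound.\<close> Let \<open>c\<^sub>i\<^sub>0 > c\<^sub>i\<^sub>1 > \<dots>\<close> be the elements of \<open>S\<^sub>i\<close>. The tropical product
  over \<open>j < d\<close> of the linear forms \<open>max(0, x\<^sub>1 - c\<^sub>1\<^sub>j, \<dots>, x\<^sub>n - c\<^sub>n\<^sub>j)\<close> has total degree \<open>d\<close>.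
  If some coordinate of a grid point \<open>a\<close> is among the \<open>d\<close> largest of its set, take the least
  \<open>j\<close> with \<open>a\<^sub>i = c\<^sub>i\<^sub>j\<close> for some \<open>i\<close>. All \<open>a\<^sub>m - c\<^sub>m\<^sub>j\<close> are then nonpositive, so that the
  \<open>j\<close>-th factor has its maximum \<open>0\<close> attained twice. Thus at most \<open>\<Prod>(k\<^sub>i - d)\<close> grid points are
  non-roots.
\<close>

section \<open>Underdetermined tropical linear systems\<close>

text \<open>
  This is Cramer's rule: the coefficient of column \<open>j\<close> is the maximal weight of an injection
  from the rows into the remaining columns. Redirecting the row \<open>a\<close> of an optimal injection
  from its column \<open>j'\<close> to \<open>j\<close> gives an injection avoiding \<open>j'\<close>, and comparing weights gives
  the inequality. Applied to a column \<open>j\<close> that is maximal in row \<open>a\<close>, the conclusion says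
  that the maximum of that row is attained twice.
\<close>

lemma underdetermined_tropical_system:
  fixes M :: "'a \<Rightarrow> 'b \<Rightarrow> real"
  assumes "finite A" "finite C" "card A < card C"
  shows "\<exists>c. \<forall>a\<in>A. \<forall>j\<in>C. \<exists>j'\<in>C. j' \<noteq> j \<and> c j + M a j \<le> c j' + M a j'"
proof -
  define injs where "injs j = {f \<in> A \<rightarrow>\<^sub>E (C - {j}). inj_on f A}" for j
  define weight where "weight f = (\<Sum>a\<in>A. M a (f a))" for f
  define c where "c j = Max (weight ` injs j)" for j
  have fin: "finite (injs j)" for j
    unfolding injs_def using assms by (simp add: finite_PiE)
  have ne: "injs j \<noteq> {}" if "j \<in> C" for j
  proof -
    have "card A \<le> card (C - {j})"
      using assms that by simp
    then obtain f where "f ` A \<subseteq> C - {j}" "inj_on f A"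
      using card_le_inj[of A "C - {j}"] assms by auto
    then have "restrict f A \<in> injs j"
      unfolding injs_def by (auto simp: inj_on_def)
    then show ?thesis by blast
  qed
  have "\<exists>j'\<in>C. j' \<noteq> j \<and> c j + M a j \<le> c j' + M a j'" if a: "a \<in> A" and j: "j \<in> C" for a j
  proof -
    have "c j \<in> weight ` injs j"
      unfolding c_def using fin ne[OF j] by (intro Max_in) auto
    then obtain f where f: "f \<in> injs j" "c j = weight f"
      by auto
    have fa: "f a \<in> C" "f a \<noteq> j"
      using f(1) a unfolding injs_def by auto
    have "f(a := j) \<in> injs (f a)"
      using f(1) a j unfolding injs_def
      by (auto simp: inj_on_def PiE_iff extensional_def)
    then have "weight (f(a := j)) \<le> c (f a)"
      unfolding c_def using fin by (intro Max_ge) auto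
    moreover have "weight f = M a (f a) + (\<Sum>b\<in>A - {a}. M b (f b))"
      unfolding weight_def using a assms(1) by (rule sum.remove[rotated])
    moreover have "weight (f(a := j)) = M a j + (\<Sum>b\<in>A - {a}. M b (f b))"
      unfolding weight_def using a assms(1) by (simp add: sum.remove)
    ultimately show ?thesis
      using fa f(2) by (intro bexI[of _ "f a"]) auto
  qed
  then show ?thesis by blast
qed

section \<open>A convex potential for a finite set of reals\<close>

text \<open>
  The piecewise linear function with slope halfway between \<open>s v\<close> and \<open>s (Suc v)\<close> on the interval
  from \<open>v\<close> to \<open>Suc v\<close>; for increasing \<open>s\<close> the value \<open>s t\<close> then lies strictly between the two
  slopes that meet at \<open>t\<close>.
\<close>

definition convex_potential :: "(nat \<Rightarrow> real) \<Rightarrow> nat \<Rightarrow> real" where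
  "convex_potential s u = (\<Sum>v<u. (s v + s (Suc v)) / 2)"

lemma convex_potential_Suc:
  "convex_potential s (Suc u) = convex_potential s u + (s u + s (Suc u)) / 2"
  by (simp add: convex_potential_def)

lemma convex_potential_strict_subgradient:
  assumes mono: "\<And>u v. u < v \<Longrightarrow> v < k \<Longrightarrow> s u < s v"
    and "t < k" "u < k" "u \<noteq> t"
  shows "s t * (real u - real t) < convex_potential s u - convex_potential s t"
proof -
  have "t < v \<Longrightarrow> v < k \<Longrightarrow>
      s t * (real v - real t) < convex_potential s v - convex_potential s t" for v
  proof (induction v)
    case (Suc v)
    show ?case
    proof (cases "v = t")
      case True
      then show ?thesis
        using mono[of t "Suc t"] Suc.prems by (simp add: convex_potential_Suc)
    next
      case False
      then have "s t < s v" "s t < s (Suc v)"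
        using mono Suc.prems by auto
      then show ?thesis
        using Suc False by (simp add: convex_potential_Suc field_simps)
    qed
  qed simp
  moreover have "u < v \<Longrightarrow> v < k \<Longrightarrow>
      convex_potential s v - convex_potential s u < s v * (real v - real u)" for v
  proof (induction v)
    case (Suc v)
    have lt: "s v < s (Suc v)"
      using mono Suc.prems by auto
    show ?case
    proof (cases "v = u")
      case True
      then show ?thesis
        using lt by (simp add: convex_potential_Suc)
    next
      case False
      then have "convex_potential s v - convex_potential s u < s v * (real v - real u)"
        using Suc by auto
      also have "\<dots> \<le> s (Suc v) * (real v - real u)"
        using lt Suc.prems by (intro mult_right_mono) auto
      finally show ?thesis
        using lt by (simp add: convex_potential_Suc field_simps)
    qed
  qed simp
  ultimately show ?thesis
    using assms by (cases "t < u") (force simp: algebra_simps)+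
qed

abbreviation enum :: "real set \<Rightarrow> nat \<Rightarrow> real" where
  "enum X t \<equiv> sorted_list_of_set X ! t"

lemma enum_strict_mono: "u < v \<Longrightarrow> v < card X \<Longrightarrow> enum X u < enum X v"
  by (simp add: sorted_wrt_nth_less[OF strict_sorted_list_of_set])

lemma enum_image: "finite X \<Longrightarrow> enum X ` {..<card X} = X"
  using set_conv_nth[of "sorted_list_of_set X"] by auto

section \<open>The lower bound on the number of non-roots\<close>

lemma trop_rootD:
  assumes "trop_root n p a" "finite (dom p)" "J \<in> dom p"
  obtains J' where "J' \<in> dom p" "J' \<noteq> J" "monom_value n p J a \<le> monom_value n p J' a"
proof -
  have "monom_value n p J a \<le> trop_value n p a"
    unfolding trop_value_def using assms by (intro Max_ge) auto
  then show ?thesis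
    using assms(1) that unfolding trop_root_def by metis
qed

text \<open>
  If there were fewer non-roots, some tropical polynomial \<open>q\<close> with \<open>\<Prod>(k\<^sub>i - d\<^sub>i)\<close> possible
  exponent vectors would have all of them as roots. The exponents of \<open>p q\<close> index grid points, and the
  optimal pair \<open>(J, v)\<close> of monomials, measured by coefficients plus convex potential of
  \<open>J + v\<close>, strictly dominates at the grid point with index \<open>J + v\<close> every pair with another sum.
  Varying only one member of the pair shows that this point is a root of neither \<open>p\<close> nor \<open>q\<close>.
\<close>

theorem card_nonroots_ge:
  assumes fin: "finite (dom p)" and ne: "dom p \<noteq> {}"
    and deg: "dom p \<subseteq> (\<Pi>\<^sub>E i\<in>{1..n}. {..d i})"
    and S: "\<And>i. i \<in> {1..n} \<Longrightarrow> finite (S i)"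
  shows "(\<Prod>i\<in>{1..n}. card (S i) - d i) \<le> card {a \<in> (\<Pi>\<^sub>E i\<in>{1..n}. S i). \<not> trop_root n p a}"
    (is "_ \<le> card ?N")
proof (rule ccontr)
  assume few: "\<not> ?thesis"
  let ?C = "\<Pi>\<^sub>E i\<in>{1..n}. {..<card (S i) - d i}"
  have cardC: "card ?C = (\<Prod>i\<in>{1..n}. card (S i) - d i)"
    by (simp add: card_PiE)
  have finC: "finite ?C"
    by (simp add: finite_PiE)
  have finN: "finite ?N"
    using finite_PiE[of "{1..n}" S] S by simp
  have lt: "card ?N < card ?C"
    using few cardC by simp
  from underdetermined_tropical_system[OF finN finC lt,
      of "\<lambda>a v. \<Sum>i\<in>{1..n}. real (v i) * a i"]
  obtain c where c: "\<forall>a\<in>?N. \<forall>v\<in>?C. \<exists>v'\<in>?C. v' \<noteq> v \<and>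
      c v + (\<Sum>i\<in>{1..n}. real (v i) * a i) \<le> c v' + (\<Sum>i\<in>{1..n}. real (v' i) * a i)" ..
  \<comment> \<open>From here on, \<open>c\<close> are the coefficients of the auxiliary polynomial \<open>q\<close> with exponents in \<open>?C\<close>.\<close>
  have neC: "?C \<noteq> {}"
    using lt by (metis card.empty not_less0)
  define \<phi> where "\<phi> i = convex_potential (enum (S i))" for i
  define F where "F = (\<lambda>(J, v). the (p J) + c v + (\<Sum>i\<in>{1..n}. \<phi> i (J i + v i)))"
  have finP: "finite (dom p \<times> ?C)" and neP: "dom p \<times> ?C \<noteq> {}"
    using fin finC ne neC by auto
  have "Max (F ` (dom p \<times> ?C)) \<in> F ` (dom p \<times> ?C)"
    using finP neP by (intro Max_in) auto
  then obtain J v where Jv: "J \<in> dom p" "v \<in> ?C"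
    and "Max (F ` (dom p \<times> ?C)) = F (J, v)"
    by (elim imageE SigmaE) simp
  then have opt: "F (J', v') \<le> F (J, v)" if "J' \<in> dom p" "v' \<in> ?C" for J' v'
  proof -
    have "F (J', v') \<le> Max (F ` (dom p \<times> ?C))"
      using that finP by (intro Max_ge finite_imageI imageI SigmaI)
    then show ?thesis
      using \<open>Max (F ` (dom p \<times> ?C)) = F (J, v)\<close> by simp
  qed
  have less: "J' i + v' i < card (S i)" if "J' \<in> dom p" "v' \<in> ?C" "i \<in> {1..n}" for J' v' i
  proof -
    have "J' i \<le> d i" "v' i < card (S i) - d i"
      using that deg by (auto simp: PiE_iff)
    then show ?thesis by linarith
  qed
  define a where "a = (\<lambda>i\<in>{1..n}. enum (S i) (J i + v i))"
  have a_in: "a \<in> (\<Pi>\<^sub>E i\<in>{1..n}. S i)"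
    unfolding a_def
  proof (intro restrict_PiE_iff[THEN iffD2] ballI)
    fix i assume i: "i \<in> {1..n}"
    have "enum (S i) (J i + v i) \<in> enum (S i) ` {..<card (S i)}"
      using less[OF Jv i] by (intro imageI) simp
    then show "enum (S i) (J i + v i) \<in> S i"
      using enum_image[OF S[OF i]] by simp
  qed
  have dominates: "monom_value n p J' a + (c v' + (\<Sum>i\<in>{1..n}. real (v' i) * a i))
      < monom_value n p J a + (c v + (\<Sum>i\<in>{1..n}. real (v i) * a i))"
    if J'v': "J' \<in> dom p" "v' \<in> ?C" and diff: "\<exists>i\<in>{1..n}. J' i + v' i \<noteq> J i + v i" for J' v'
  proof -
    \<comment> \<open>Moving from exponent \<open>J + v\<close> to \<open>J' + v'\<close> changes the linear part at \<open>a\<close> by the sum of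
        these terms, which is less than the change of the potential as \<open>a\<close> is its subgradient.\<close>
    let ?gap = "\<lambda>i. a i * (real (J' i + v' i) - real (J i + v i))"
    have strict: "?gap i < \<phi> i (J' i + v' i) - \<phi> i (J i + v i)"
      if "i \<in> {1..n}" "J' i + v' i \<noteq> J i + v i" for i
      unfolding \<phi>_def a_def restrict_apply'[OF that(1)]
      using enum_strict_mono less[OF Jv that(1)] less[OF J'v' that(1)] that(2)
      by (rule convex_potential_strict_subgradient)
    have weak: "?gap i \<le> \<phi> i (J' i + v' i) - \<phi> i (J i + v i)" if "i \<in> {1..n}" for i
      using strict[OF that] by (cases "J' i + v' i = J i + v i") auto
    obtain i where i: "i \<in> {1..n}" "J' i + v' i \<noteq> J i + v i"
      using diff by blast
    have "(\<Sum>i\<in>{1..n}. ?gap i)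
        < (\<Sum>i\<in>{1..n}. \<phi> i (J' i + v' i) - \<phi> i (J i + v i))"
      using weak strict[OF i] i(1)
      by (intro sum_strict_mono_ex1 ballI bexI[of _ i] finite_atLeastAtMost)
    moreover have "(\<Sum>i\<in>{1..n}. ?gap i) =
        (\<Sum>i\<in>{1..n}. real (J' i) * a i) + (\<Sum>i\<in>{1..n}. real (v' i) * a i)
        - (\<Sum>i\<in>{1..n}. real (J i) * a i) - (\<Sum>i\<in>{1..n}. real (v i) * a i)"
      by (simp add: algebra_simps sum.distrib sum_subtractf)
    ultimately show ?thesis
      using opt[OF J'v'] by (simp add: F_def monom_value_def sum_subtractf)
  qed
  have "\<not> trop_root n p a"
  proof
    assume "trop_root n p a"
    then obtain J' where J': "J' \<in> dom p" "J' \<noteq> J" "monom_value n p J a \<le> monom_value n p J' a"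
      using trop_rootD[OF _ fin Jv(1)] by metis
    moreover have "\<exists>i\<in>{1..n}. J' i \<noteq> J i"
      using PiE_ext[OF subsetD[OF deg J'(1)] subsetD[OF deg Jv(1)]] J'(2) by blast
    ultimately show False
      using dominates[of J' v] Jv(2) by auto
  qed
  then have "a \<in> ?N"
    using a_in by simp
  then obtain v' where v': "v' \<in> ?C" "v' \<noteq> v"
    "c v + (\<Sum>i\<in>{1..n}. real (v i) * a i) \<le> c v' + (\<Sum>i\<in>{1..n}. real (v' i) * a i)"
    using bspec[OF bspec[OF c] Jv(2)] by blast
  moreover have "\<exists>i\<in>{1..n}. v' i \<noteq> v i"
    using PiE_ext[OF v'(1) Jv(2)] v'(2) by blast
  ultimately show False
    using dominates[of J v'] Jv(1) by auto
qed

lemma num_roots_plus_nonroots: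
  assumes "\<And>i. i \<in> {1..n} \<Longrightarrow> finite (S i)"
  shows "num_roots n p S + card {a \<in> (\<Pi>\<^sub>E i\<in>{1..n}. S i). \<not> trop_root n p a}
    = (\<Prod>i\<in>{1..n}. card (S i))"
proof -
  let ?P = "\<Pi>\<^sub>E i\<in>{1..n}. S i"
  have "finite ?P"
    using assms by (intro finite_PiE) auto
  moreover have "?P = {a \<in> ?P. trop_root n p a} \<union> {a \<in> ?P. \<not> trop_root n p a}"
    by blast
  ultimately have "card ?P
      = card {a \<in> ?P. trop_root n p a} + card {a \<in> ?P. \<not> trop_root n p a}"
    by (subst card_Un_disjoint[symmetric]) auto
  then show ?thesis
    by (simp add: num_roots_def card_PiE)
qed

section \<open>A product of linear forms with many roots\<close>

text \<open>
  A formally expanded product is a family of terms in which an exponent vector may occur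
  repeatedly; terms with equal exponents have to be merged.
\<close>

definition collect_terms :: "'t set \<Rightarrow> ('t \<Rightarrow> expvec) \<Rightarrow> ('t \<Rightarrow> real) \<Rightarrow> trop_poly" where
  "collect_terms T E c J = (if J \<in> E ` T then Some (Max (c ` {t \<in> T. E t = J})) else None)"

lemma dom_collect_terms: "dom (collect_terms T E c) = E ` T"
  by (auto simp: collect_terms_def dom_def split: if_splits)

lemma collect_terms_attained:
  assumes "finite T" "J \<in> E ` T"
  obtains t where "t \<in> T" "E t = J" "collect_terms T E c J = Some (c t)"
proof -
  have "Max (c ` {t \<in> T. E t = J}) \<in> c ` {t \<in> T. E t = J}"
    using assms by (intro Max_in) auto
  then show ?thesis
    using that assms(2) by (auto simp: collect_terms_def)
qed

lemma collect_terms_ge: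
  assumes "finite T" "t \<in> T"
  shows "c t \<le> the (collect_terms T E c (E t))"
  using assms by (auto simp: collect_terms_def intro!: Max_ge)

lemma trop_root_collect_terms:
  assumes fin: "finite T" and T: "t \<in> T" "t' \<in> T" "E t \<noteq> E t'"
    and max: "\<And>u. u \<in> T \<Longrightarrow> c u + (\<Sum>i\<in>{1..n}. real (E u i) * x i) \<le> B"
    and att: "c t + (\<Sum>i\<in>{1..n}. real (E t i) * x i) = B"
      "c t' + (\<Sum>i\<in>{1..n}. real (E t' i) * x i) = B"
  shows "trop_root n (collect_terms T E c) x"
proof -
  let ?p = "collect_terms T E c"
  have le: "monom_value n ?p J x \<le> B" if "J \<in> E ` T" for J
  proof -
    obtain u where "u \<in> T" "E u = J" "?p J = Some (c u)"
      using collect_terms_attained[OF fin \<open>J \<in> E ` T\<close>] .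
    then show ?thesis
      using max[of u] by (simp add: monom_value_def)
  qed
  have ge: "c u + (\<Sum>i\<in>{1..n}. real (E u i) * x i) \<le> monom_value n ?p (E u) x"
    if "u \<in> T" for u
    using collect_terms_ge[OF fin that] by (simp add: monom_value_def)
  have eq: "monom_value n ?p (E t) x = B" "monom_value n ?p (E t') x = B"
    using le[OF imageI[OF T(1)]] le[OF imageI[OF T(2)]] ge[OF T(1)] ge[OF T(2)] att
    by linarith+
  have "trop_value n ?p x = B"
    unfolding trop_value_def dom_collect_terms
  proof (rule Max_eqI)
    show "B \<in> (\<lambda>J. monom_value n ?p J x) ` E ` T"
      using eq(1) T(1) by blast
  qed (use fin le in auto)
  then show ?thesis
    unfolding trop_root_def dom_collect_terms using eq T by blast
qed

text \<open>
  A term of the product of the \<open>d\<close> linear forms \<open>max(0, x\<^sub>1 - c\<^sub>1\<^sub>j, \<dots>, x\<^sub>n - c\<^sub>n\<^sub>j)\<close> is given by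
  the choice \<open>g j \<in> {0..n}\<close> of a summand in each factor \<open>j < d\<close>, where \<open>0\<close> stands for the
  constant summand \<open>0\<close>.
\<close>

definition choices :: "nat \<Rightarrow> nat \<Rightarrow> (nat \<Rightarrow> nat) set" where
  "choices n d = {..<d} \<rightarrow>\<^sub>E {0..n}"

definition choice_exponent :: "nat \<Rightarrow> nat \<Rightarrow> (nat \<Rightarrow> nat) \<Rightarrow> expvec" where
  "choice_exponent n d g = (\<lambda>i\<in>{1..n}. card {j \<in> {..<d}. g j = i})"

definition choice_const :: "nat \<Rightarrow> (nat \<Rightarrow> nat \<Rightarrow> real) \<Rightarrow> (nat \<Rightarrow> nat) \<Rightarrow> real" where
  "choice_const d c g = (\<Sum>j<d. if g j = 0 then 0 else - c (g j) j)"

definition linear_product :: "nat \<Rightarrow> nat \<Rightarrow> (nat \<Rightarrow> nat \<Rightarrow> real) \<Rightarrow> trop_poly" where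
  "linear_product n d c = collect_terms (choices n d) (choice_exponent n d) (choice_const d c)"

lemma finite_choices: "finite (choices n d)"
  by (simp add: choices_def finite_PiE)

lemma choice_exponent_weighted_sum:
  fixes x :: "nat \<Rightarrow> 'a::semiring_1"
  assumes "g \<in> choices n d"
  shows "(\<Sum>i\<in>{1..n}. of_nat (choice_exponent n d g i) * x i)
    = (\<Sum>j<d. if g j = 0 then 0 else x (g j))"
proof -
  have "(\<Sum>i\<in>{1..n}. of_nat (choice_exponent n d g i) * x i)
      = (\<Sum>i\<in>{1..n}. \<Sum>j<d. if g j = i then x i else 0)"
    by (intro sum.cong) (simp_all add: choice_exponent_def sum.If_cases Int_def)
  also have "\<dots> = (\<Sum>j<d. \<Sum>i\<in>{1..n}. if g j = i then x i else 0)"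
    by (rule sum.swap)
  also have "\<dots> = (\<Sum>j<d. if g j = 0 then 0 else x (g j))"
  proof (intro sum.cong refl)
    fix j assume "j \<in> {..<d}"
    then have "g j \<le> n"
      using assms by (auto simp: choices_def PiE_iff)
    then show "(\<Sum>i\<in>{1..n}. if g j = i then x i else 0) = (if g j = 0 then 0 else x (g j))"
      by (simp add: sum.delta')
  qed
  finally show ?thesis .
qed

lemma choice_value:
  assumes "g \<in> choices n d"
  shows "choice_const d c g + (\<Sum>i\<in>{1..n}. real (choice_exponent n d g i) * x i)
    = (\<Sum>j<d. if g j = 0 then 0 else x (g j) - c (g j) j)"
  unfolding choice_const_def choice_exponent_weighted_sum[OF assms] sum.distrib[symmetric]
  by (intro sum.cong) auto

lemma trop_degree_linear_product:
  assumes "n \<ge> 1"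
  shows "trop_degree n (linear_product n d c) = d"
proof -
  have deg: "(\<Sum>i\<in>{1..n}. choice_exponent n d g i) = (\<Sum>j<d. if g j = 0 then 0 else 1)"
    if "g \<in> choices n d" for g
    using choice_exponent_weighted_sum[OF that, of "\<lambda>_. 1 :: nat"] by simp
  have "Max ((\<lambda>J. \<Sum>i\<in>{1..n}. J i) ` choice_exponent n d ` choices n d) = d"
  proof (rule Max_eqI)
    fix y assume "y \<in> (\<lambda>J. \<Sum>i\<in>{1..n}. J i) ` choice_exponent n d ` choices n d"
    then obtain g where "g \<in> choices n d" "y = (\<Sum>j<d. if g j = 0 then 0 else 1)"
      using deg by auto
    then show "y \<le> d"
      using sum_bounded_above[of "{..<d}" "\<lambda>j. if g j = 0 then 0 else 1" "1 :: nat"] by simp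
  next
    \<comment> \<open>The choice of \<open>x\<^sub>1\<close> in every factor has full degree.\<close>
    define g where "g = (\<lambda>j\<in>{..<d}. 1 :: nat)"
    have g: "g \<in> choices n d"
      using assms by (auto simp: g_def choices_def)
    moreover have "(\<Sum>i\<in>{1..n}. choice_exponent n d g i) = d"
      using deg[OF g] by (simp add: g_def)
    ultimately show "d \<in> (\<lambda>J. \<Sum>i\<in>{1..n}. J i) ` choice_exponent n d ` choices n d"
      by force
  qed (simp add: finite_choices)
  then show ?thesis
    by (simp add: trop_degree_def linear_product_def dom_collect_terms)
qed

lemma dom_linear_product_nonempty: "dom (linear_product n d c) \<noteq> {}"
proof -
  have "(\<lambda>j\<in>{..<d}. 0) \<in> choices n d"
    by (auto simp: choices_def)
  then show ?thesis
    by (auto simp: linear_product_def dom_collect_terms)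
qed

lemma linear_product_over:
  assumes K: "K = UNIV \<or> K = \<rat>"
    and c: "\<And>i j. i \<in> {1..n} \<Longrightarrow> j < d \<Longrightarrow> c i j \<in> K"
  shows "trop_poly_over K n (linear_product n d c)"
proof -
  have const: "choice_const d c g \<in> K" if "g \<in> choices n d" for g
    using K
  proof
    assume "K = \<rat>"
    moreover have "(if g j = 0 then 0 else - c (g j) j) \<in> \<rat>" if "j < d" for j
    proof -
      have "g j \<le> n"
        using \<open>g \<in> choices n d\<close> that by (auto simp: choices_def PiE_iff)
      then show ?thesis
        using c[of "g j" j] that \<open>K = \<rat>\<close> by simp
    qed
    ultimately show ?thesis
      unfolding choice_const_def \<open>K = \<rat>\<close> by (intro Rats_sum) simp
  qed simp
  have "y \<in> K" if J: "linear_product n d c J = Some y" for J y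
  proof -
    have "J \<in> choice_exponent n d ` choices n d"
      using domI[of "linear_product n d c", OF J]
      by (simp add: linear_product_def dom_collect_terms)
    then obtain g where "g \<in> choices n d" "linear_product n d c J = Some (choice_const d c g)"
      using collect_terms_attained[OF finite_choices] unfolding linear_product_def by metis
    then show ?thesis
      using J const by simp
  qed
  then have "ran (linear_product n d c) \<subseteq> K"
    by (auto simp: ran_def)
  moreover have "dom (linear_product n d c) \<subseteq> {1..n} \<rightarrow>\<^sub>E UNIV"
    by (auto simp: linear_product_def dom_collect_terms choice_exponent_def)
  ultimately show ?thesis
    using finite_choices
    by (simp add: trop_poly_over_def linear_product_def dom_collect_terms)
qed

text \<open>
  The hypotheses say that in the \<open>j\<close>-th factor the constant \<open>0\<close> and the summand \<open>x\<^sub>i - c\<^sub>i\<^sub>j\<close>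
  both attain the maximum; a root of a factor is a root of the product.
\<close>

lemma trop_root_linear_product:
  assumes j: "j < d" and i: "i \<in> {1..n}" "x i = c i j"
    and le: "\<And>m. m \<in> {1..n} \<Longrightarrow> x m \<le> c m j"
  shows "trop_root n (linear_product n d c) x"
proof -
  define l where "l k m = (if m = 0 then 0 else x m - c m k)" for k m
  have "\<exists>m\<in>{0..n}. \<forall>m'\<in>{0..n}. l k m' \<le> l k m" for k
  proof -
    have "Max (l k ` {0..n}) \<in> l k ` {0..n}"
      by (intro Max_in) auto
    then obtain m where "m \<in> {0..n}" "Max (l k ` {0..n}) = l k m"
      by blast
    moreover have "l k m' \<le> Max (l k ` {0..n})" if "m' \<in> {0..n}" for m'
      using that by (intro Max_ge) auto
    ultimately show ?thesis
      by (intro bexI[of _ m]) auto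
  qed
  then obtain h where h: "\<And>k. h k \<in> {0..n}" "\<And>k m. m \<in> {0..n} \<Longrightarrow> l k m \<le> l k (h k)"
    by metis
  have lj: "l j m \<le> 0" if "m \<in> {0..n}" for m
    using le[of m] that by (auto simp: l_def)
  have li: "l j i = 0"
    using i by (simp add: l_def)
  \<comment> \<open>Both choices are optimal in every factor. They differ in factor \<open>j\<close> only, where the
      constant and the \<open>i\<close>-th summand tie, so that their exponents of \<open>x\<^sub>i\<close> differ by one.\<close>
  define g where "g = (\<lambda>k\<in>{..<d}. if k = j then 0 else h k)"
  define g' where "g' = (\<lambda>k\<in>{..<d}. if k = j then i else h k)"
  have g: "g \<in> choices n d" and g': "g' \<in> choices n d"
    using h(1) i(1) by (auto simp: g_def g'_def choices_def)
  have "{k \<in> {..<d}. g' k = i} = insert j {k \<in> {..<d}. g k = i}" "j \<notin> {k \<in> {..<d}. g k = i}"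
    using j i(1) by (auto simp: g_def g'_def)
  then have "choice_exponent n d g' i = Suc (choice_exponent n d g i)"
    using i(1) by (simp add: choice_exponent_def)
  then have ne: "choice_exponent n d g \<noteq> choice_exponent n d g'"
    by force
  have opt: "l k (u k) \<le> l k (g k)" if "u \<in> choices n d" "k < d" for u k
  proof -
    have "u k \<in> {0..n}"
      using that by (auto simp: choices_def PiE_iff)
    then show ?thesis
      using h(2) lj that(2) by (cases "k = j") (auto simp: g_def l_def[of _ 0])
  qed
  have val: "choice_const d c u + (\<Sum>i\<in>{1..n}. real (choice_exponent n d u i) * x i)
      = (\<Sum>k<d. l k (u k))" if "u \<in> choices n d" for u
    unfolding choice_value[OF that] l_def ..
  have "(\<Sum>k<d. l k (g' k)) = (\<Sum>k<d. l k (g k))"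
    using li by (intro sum.cong) (auto simp: g_def g'_def l_def)
  moreover have "(\<Sum>k<d. l k (u k)) \<le> (\<Sum>k<d. l k (g k))" if "u \<in> choices n d" for u
    using opt[OF that] by (intro sum_mono) auto
  ultimately show ?thesis
    unfolding linear_product_def
    using g g' ne
    by (intro trop_root_collect_terms[OF finite_choices, where B = "\<Sum>k<d. l k (g k)"])
      (auto simp only: val)
qed

section \<open>The maximal number of roots\<close>

text \<open>
  With \<open>c i j\<close> running downwards through \<open>S i\<close>, a non-root must avoid the \<open>d\<close> largest
  elements of every \<open>S i\<close>: otherwise the factor indexed by the smallest rank, counted from the
  top, of a coordinate of the point has a tie.
\<close>

lemma num_roots_linear_product_ge:
  fixes S :: "nat \<Rightarrow> real set"
  defines "c \<equiv> \<lambda>i j. enum (S i) (card (S i) - Suc j)"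
  assumes S: "\<And>i. i \<in> {1..n} \<Longrightarrow> finite (S i)"
    and d: "\<And>i. i \<in> {1..n} \<Longrightarrow> d \<le> card (S i)"
  shows "(\<Prod>i\<in>{1..n}. card (S i))
    \<le> num_roots n (linear_product n d c) S + (\<Prod>i\<in>{1..n}. card (S i) - d)"
proof -
  let ?p = "linear_product n d c"
  let ?low = "\<Pi>\<^sub>E i\<in>{1..n}. enum (S i) ` {..<card (S i) - d}"
  have "{a \<in> (\<Pi>\<^sub>E i\<in>{1..n}. S i). \<not> trop_root n ?p a} \<subseteq> ?low"
  proof (intro subsetI, rule ccontr)
    fix a assume a: "a \<in> {a \<in> (\<Pi>\<^sub>E i\<in>{1..n}. S i). \<not> trop_root n ?p a}" and "a \<notin> ?low"
    define rank where "rank i = (SOME t. t < card (S i) \<and> a i = c i t)" for i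
    have rank: "rank i < card (S i)" "a i = c i (rank i)" if "i \<in> {1..n}" for i
    proof -
      have "a i \<in> enum (S i) ` {..<card (S i)}"
        using a that enum_image[OF S[OF that]] by (auto simp: PiE_iff)
      then obtain u where "u < card (S i)" "a i = enum (S i) u"
        by auto
      then have "card (S i) - Suc u < card (S i) \<and> a i = c i (card (S i) - Suc u)"
        by (simp add: c_def)
      then have "rank i < card (S i) \<and> a i = c i (rank i)"
        unfolding rank_def by (rule someI)
      then show "rank i < card (S i)" "a i = c i (rank i)"
        by auto
    qed
    obtain i where i: "i \<in> {1..n}" "a i \<notin> enum (S i) ` {..<card (S i) - d}"
      using a \<open>a \<notin> ?low\<close> by (auto simp: PiE_iff)
    have "\<not> card (S i) - Suc (rank i) < card (S i) - d"
      using i(2) rank(2)[OF i(1)] by (auto simp: c_def)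
    then have top: "rank i < d"
      using rank(1)[OF i(1)] by linarith
    obtain m where m: "m \<in> {1..n}" "\<And>m'. m' \<in> {1..n} \<Longrightarrow> rank m \<le> rank m'"
    proof
      have ne: "{1..n} \<noteq> {}"
        using i(1) by blast
      show "arg_min_on rank {1..n} \<in> {1..n}"
        using arg_min_if_finite(1)[OF finite_atLeastAtMost ne] .
      show "rank (arg_min_on rank {1..n}) \<le> rank m'" if "m' \<in> {1..n}" for m'
        using arg_min_least[OF finite_atLeastAtMost ne that] .
    qed
    have "trop_root n ?p a"
    proof (rule trop_root_linear_product)
      show "rank m < d"
        using m(2)[OF i(1)] top by simp
      show "m \<in> {1..n}" "a m = c m (rank m)"
        using m(1) rank by auto
      fix m' assume m': "m' \<in> {1..n}"
      show "a m' \<le> c m' (rank m)"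
      proof (cases "rank m' = rank m")
        case False
        then have "enum (S m') (card (S m') - Suc (rank m'))
            < enum (S m') (card (S m') - Suc (rank m))"
          using m(2)[OF m'] rank(1)[OF m'] by (intro enum_strict_mono) auto
        then show ?thesis
          using rank(2)[OF m'] by (simp add: c_def)
      qed (use rank(2)[OF m'] in simp)
    qed
    then show False
      using a by simp
  qed
  then have "card {a \<in> (\<Pi>\<^sub>E i\<in>{1..n}. S i). \<not> trop_root n ?p a} \<le> card ?low"
    by (intro card_mono) (simp_all add: finite_PiE)
  also have "\<dots> \<le> (\<Prod>i\<in>{1..n}. card (S i) - d)"
  proof -
    have "card (enum (S i) ` {..<card (S i) - d}) \<le> card (S i) - d" for i
      using card_image_le[of "{..<card (S i) - d}"] by simp
    then show ?thesis
      by (simp add: card_PiE prod_mono)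
  qed
  finally show ?thesis
    using num_roots_plus_nonroots[where S = S and n = n and p = ?p, OF S] by linarith
qed

lemma indiv_degree_le_trop_degree:
  assumes "finite (dom p)" "dom p \<noteq> {}" "i \<in> {1..n}"
  shows "indiv_degree p i \<le> trop_degree n p"
proof -
  have "J i \<le> trop_degree n p" if "J \<in> dom p" for J
  proof -
    have "J i \<le> (\<Sum>i\<in>{1..n}. J i)"
      using assms(3) by (intro member_le_sum) auto
    also have "\<dots> \<le> trop_degree n p"
      unfolding trop_degree_def using assms(1) that by (intro Max_ge) auto
    finally show ?thesis .
  qed
  then show ?thesis
    unfolding indiv_degree_def using assms by simp
qed

theorem theorem7:
  fixes K :: "real set" and n d :: nat and S :: "nat \<Rightarrow> real set"
  assumes "K = UNIV \<or> K = \<rat>"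
    and "n \<ge> 1"
    and "\<And>i. i \<in> {1..n} \<Longrightarrow> finite (S i) \<and> S i \<subseteq> K"
    and "d \<le> Min ((\<lambda>i. card (S i)) ` {1..n})"
  shows "is_maximum
           {int (num_roots n p S) | p.
              trop_poly_over K n p \<and> dom p \<noteq> {} \<and> trop_degree n p = d}
           ((\<Prod>i\<in>{1..n}. int (card (S i))) - (\<Prod>i\<in>{1..n}. int (card (S i)) - int d))
       \<and> is_maximum
           {int (num_roots n p S) | p.
              trop_poly_over K n p \<and> dom p \<noteq> {} \<and> (\<forall>i\<in>{1..n}. indiv_degree p i \<le> d)}
           ((\<Prod>i\<in>{1..n}. int (card (S i))) - (\<Prod>i\<in>{1..n}. int (card (S i)) - int d))"
    (is "is_maximum ?Total ?bound \<and> is_maximum ?Indiv ?bound")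
proof -
  have S: "finite (S i)" and d: "d \<le> card (S i)" if "i \<in> {1..n}" for i
    using assms(2-4) that by auto
  have bound: "?bound = int (\<Prod>i\<in>{1..n}. card (S i)) - int (\<Prod>i\<in>{1..n}. card (S i) - d)"
    using d by (simp add: of_nat_diff)
  have upper: "y \<le> ?bound" if y: "y \<in> ?Indiv" for y
  proof -
    obtain p where p: "y = int (num_roots n p S)" "trop_poly_over K n p" "dom p \<noteq> {}"
      "\<And>i. i \<in> {1..n} \<Longrightarrow> indiv_degree p i \<le> d"
      using y by blast
    have fin: "finite (dom p)"
      using p(2) by (simp add: trop_poly_over_def)
    have "J i \<le> d" if "J \<in> dom p" "i \<in> {1..n}" for J i
    proof -
      have "J i \<le> indiv_degree p i"
        unfolding indiv_degree_def using fin that(1) by (intro Max_ge) auto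
      then show ?thesis
        using p(4)[OF that(2)] by simp
    qed
    then have "dom p \<subseteq> (\<Pi>\<^sub>E i\<in>{1..n}. {..d})"
      using p(2) by (fastforce simp: trop_poly_over_def PiE_iff)
    from card_nonroots_ge[where S = S, OF fin p(3) this S]
    show ?thesis
      using num_roots_plus_nonroots[where S = S and n = n and p = p, OF S]
      unfolding bound p(1) by linarith
  qed
  have sub: "?Total \<subseteq> ?Indiv"
  proof
    fix y assume "y \<in> ?Total"
    then obtain p where p: "y = int (num_roots n p S)" "trop_poly_over K n p" "dom p \<noteq> {}"
      "trop_degree n p = d"
      by blast
    then have "\<forall>i\<in>{1..n}. indiv_degree p i \<le> d"
      using indiv_degree_le_trop_degree[of p] by (auto simp: trop_poly_over_def)
    then show "y \<in> ?Indiv"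
      using p(1-3) by blast
  qed
  define p where "p = linear_product n d (\<lambda>i j. enum (S i) (card (S i) - Suc j))"
  have "enum (S i) (card (S i) - Suc j) \<in> K" if "i \<in> {1..n}" "j < d" for i j
  proof -
    have "enum (S i) (card (S i) - Suc j) \<in> enum (S i) ` {..<card (S i)}"
      using d[OF that(1)] that(2) by (intro imageI) simp
    then show ?thesis
      using enum_image[OF S[OF that(1)]] assms(3)[OF that(1)] by auto
  qed
  then have "trop_poly_over K n p"
    unfolding p_def using assms(1) by (intro linear_product_over)
  moreover have "dom p \<noteq> {}" "trop_degree n p = d"
    unfolding p_def
    by (rule dom_linear_product_nonempty, rule trop_degree_linear_product[OF assms(2)])
  ultimately have in_Total: "int (num_roots n p S) \<in> ?Total"
    by blast
  have "?bound \<le> int (num_roots n p S)"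
    using num_roots_linear_product_ge[where S = S and n = n, OF S d] unfolding bound p_def by linarith
  moreover have "int (num_roots n p S) \<le> ?bound"
    using in_Total sub by (intro upper) (rule subsetD)
  ultimately have attained: "?bound = int (num_roots n p S)"
    by (rule antisym)
  show ?thesis
    unfolding is_maximum_def
  proof (intro conjI ballI)
    show "?bound \<in> ?Total"
      unfolding attained by (rule in_Total)
    then show "?bound \<in> ?Indiv"
      using sub by (rule subsetD[rotated])
  next
    fix y assume "y \<in> ?Total"
    then show "y \<le> ?bound"
      using sub by (intro upper) (rule subsetD[rotated])
  qed (rule upper)
qed

end
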